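(* Let $d\ge 1$ be an integer and $\alpha>0$ a real number. For a function $a:\mathbb{Z}^d\to[0,\infty)$ with $a\not\equiv 0$, consider the initial value problem $$f^{\tau+1}_{\vec n}=\frac{g^\tau_{\vec n}}{\{1-(g^\tau_{\vec n})^\alpha\}^{1/\alpha}}\quad(\tau\in\mathbb{Z}_{\ge 0},\ \vec n\in\mathbb{Z}^d),\qquad f^0_{\vec n}=a(\vec n),\qquad (\ast)$$ where $g^\tau_{\vec n}=\frac{1}{2d}\sum_{k=1}^d\left(f^\tau_{\vec n+\vec e_k}+f^\tau_{\vec n-\vec e_k}\right)$. Then: (1) If $0<\alpha<2/d$, there is no global solution to $(\ast)$ (for any initial function $a\ge 0$, $a\not\equiv 0$). (2) If $\alpha=2/d$, there is no global solution to $(\ast)$ (for any initial function $a\ge 0$, $a\not\equiv 0$). (3) If $\alpha>2/d$, global solutions exist for sufficiently small $\|f^0\|_1$: there is $\varepsilon>0$, depending only on $d$ and $\alpha$, such that for every $a:\mathbb{Z}^d\to[0,\infty)$, $a\not\equiv 0$, with $\|f^0\|_1=\sum_{\vec n\in\mathbb{Z}^d}|a(\vec n)|<\varepsilon$, the solution of $(\ast)$ is a global solution.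
   Context: $\vec e_k\in\mathbb{Z}^d$ is the unit vector whose $k$-th component is $1$ and whose other components are $0$. The recursion is regarded as undefined at $(\tau,\vec n)$ when $g^\tau_{\vec n}\ge 1$. A solution $f^\tau_{\vec n}$ of $(\ast)$ is called a global solution (in time) if it is non-negative and uniquely determined for all $\tau\in\mathbb{Z}_{\ge 0}$ and $\vec n\in\mathbb{Z}^d$, i.e. $g^\tau_{\vec n}<1$ for all $\tau\in\mathbb{Z}_{\ge0}$ and $\vec n\in\mathbb{Z}^d$. *)

theory Defs
  imports "HOL-Analysis.Analysis"
begin

definition neighbour_mean :: "(int ^ 'd \<Rightarrow> real) \<Rightarrow> int ^ 'd \<Rightarrow> real" where
  "neighbour_mean u n =
     (1 / (2 * real CARD('d))) * (\<Sum>k\<in>UNIV. u (n + axis k 1) + u (n - axis k 1))"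

(* The recursion is undefined wherever the mean g is at least 1. A total function f
   therefore solves the problem for all times only if g < 1 everywhere; the bound must be
   demanded explicitly, since powr returns a value also when 1 - g powr \<alpha> is not positive. *)
definition solves_ivp ::
    "real \<Rightarrow> (int ^ 'd \<Rightarrow> real) \<Rightarrow> (nat \<Rightarrow> int ^ 'd \<Rightarrow> real) \<Rightarrow> bool" where
  "solves_ivp \<alpha> a f \<longleftrightarrow>
     (\<forall>n. f 0 n = a n) \<and>
     (\<forall>\<tau> n. let g = neighbour_mean (f \<tau>) n in
        g < 1 \<and> f (Suc \<tau>) n = g / (1 - g powr \<alpha>) powr (1 / \<alpha>))"

definition global_solution ::
    "real \<Rightarrow> (int ^ 'd \<Rightarrow> real) \<Rightarrow> (nat \<Rightarrow> int ^ 'd \<Rightarrow> real) \<Rightarrow> bool" where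
  "global_solution \<alpha> a f \<longleftrightarrow> solves_ivp \<alpha> a f \<and> (\<forall>\<tau> n. 0 \<le> f \<tau> n)"

end

theory Submission
  imports Defs
begin

text \<open>Let \<open>M\<close> be the neighbour mean. For positive values the recursion reads \<open>f\<^bsup>-\<alpha>\<^esup> = g\<^bsup>-\<alpha>\<^esup> - 1\<close>,
  so its \<open>t\<close>-fold iterate is inverted by \<open>\<kappa>\<^sub>t(x) = (x\<^bsup>-\<alpha>\<^esup> + t)\<^bsup>-1/\<alpha>\<^esup>\<close>, which is concave.

  Blow-up: by Jensen, \<open>M\<^sup>t a \<le> \<kappa>\<^sub>t(f\<^sup>t) < t\<^bsup>-1/\<alpha>\<^esup>\<close>. By Chebyshev, at least half of the mass of \<open>M\<^sup>t a\<close>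
  that starts near the origin sits in a ball with \<open>O(t\<^bsup>d/2\<^esup>)\<close> points, so the mass of \<open>a\<close> is
  \<open>O(t\<^bsup>d/2 - 1/\<alpha>\<^esup>)\<close>. This is absurd for \<open>\<alpha> < 2/d\<close>. For \<open>\<alpha> = 2/d\<close>, applied to all \<open>f\<^sup>s\<close> as initial data, it
  bounds the masses of all \<open>f\<^sup>s\<close> uniformly; but the nonlinearity adds at least
  \<open>\<Sum> g\<^bsup>1+\<alpha>\<^esup> / \<alpha> \<ge> c / t\<close> to the mass in each step, and the harmonic series diverges.

  Global existence: the heat kernel is at most \<open>(d/t)\<^bsup>d/2\<^esup>\<close>, and \<open>c\<^sub>t M\<^sup>t a\<close> with a suitable bounded
  sequence \<open>c\<^sub>t\<close> is a supersolution because \<open>\<Sum> t\<^bsup>-\<alpha> d/2\<^esup>\<close> converges.\<close>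

subsection \<open>The random walk\<close>

lemma neighbour_mean_mono:
  "(\<And>n. u n \<le> v n) \<Longrightarrow> neighbour_mean u n \<le> neighbour_mean v n"
  unfolding neighbour_mean_def by (intro mult_left_mono sum_mono add_mono) auto

lemma neighbour_mean_nonneg: "(\<And>n. 0 \<le> u n) \<Longrightarrow> 0 \<le> neighbour_mean u n"
  unfolding neighbour_mean_def by (intro mult_nonneg_nonneg sum_nonneg add_nonneg_nonneg) auto

lemma neighbour_mean_add: "neighbour_mean (\<lambda>n. u n + v n) n = neighbour_mean u n + neighbour_mean v n"
  unfolding neighbour_mean_def by (simp add: sum.distrib algebra_simps)

lemma neighbour_mean_cmult: "neighbour_mean (\<lambda>n. c * u n) n = c * neighbour_mean u n"
  unfolding neighbour_mean_def by (simp add: sum_distrib_left algebra_simps)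

lemma neighbour_mean_const: "neighbour_mean (\<lambda>_. c) (n :: int ^ 'd) = c"
  unfolding neighbour_mean_def by simp

lemma neighbour_mean_eq_0:
  fixes u :: "int ^ 'd \<Rightarrow> real"
  assumes "\<And>n. 0 \<le> u n" "neighbour_mean u n = 0"
  shows "u (n + axis k 1) = 0" "u (n - axis k 1) = 0"
proof -
  have "(\<Sum>k\<in>UNIV. u (n + axis k 1) + u (n - axis k 1)) = 0"
    using assms(2) by (simp add: neighbour_mean_def)
  hence "\<forall>k. u (n + axis k 1) + u (n - axis k 1) = 0"
    using assms(1) by (subst (asm) sum_nonneg_eq_0_iff) auto
  hence "u (n + axis k 1) + u (n - axis k 1) = 0" by blast
  with assms(1)[of "n + axis k 1"] assms(1)[of "n - axis k 1"]
  show "u (n + axis k 1) = 0" "u (n - axis k 1) = 0" by linarith+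
qed

lemma neighbour_mean_funpow_mono:
  "(\<And>n. u n \<le> v n) \<Longrightarrow> (neighbour_mean ^^ t) u n \<le> (neighbour_mean ^^ t) v n"
  by (induction t arbitrary: n) (auto intro: neighbour_mean_mono)

lemma neighbour_mean_funpow_nonneg:
  "(\<And>n. 0 \<le> u n) \<Longrightarrow> 0 \<le> (neighbour_mean ^^ t) u n"
  by (induction t arbitrary: n) (auto intro: neighbour_mean_nonneg)

lemma has_sum_finite_sum:
  fixes f :: "'i \<Rightarrow> 'a \<Rightarrow> real"
  assumes "\<And>i. i \<in> I \<Longrightarrow> (f i has_sum s i) A"
  shows "((\<lambda>x. \<Sum>i\<in>I. f i x) has_sum (\<Sum>i\<in>I. s i)) A"
  using assms by (induction I rule: infinite_finite_induct) (auto intro: has_sum_add)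

text \<open>The transition probabilities of the simple random walk, that is, the heat kernel of the
  lattice.\<close>

definition kernel :: "nat \<Rightarrow> int ^ 'd \<Rightarrow> real" where
  "kernel t = (neighbour_mean ^^ t) (\<lambda>n. if n = 0 then 1 else 0)"

lemma kernel_0: "kernel 0 n = (if n = 0 then 1 else 0)"
  by (simp add: kernel_def)

lemma kernel_Suc: "kernel (Suc t) n = neighbour_mean (kernel t) n"
  by (simp add: kernel_def)

lemma kernel_uminus: "kernel t (- n) = kernel t n"
proof (induction t arbitrary: n)
  case (Suc t)
  have "kernel t (- n + axis k 1) = kernel t (n - axis k 1)"
       "kernel t (- n - axis k 1) = kernel t (n + axis k 1)" for k
    using Suc[of "n - axis k 1"] Suc[of "n + axis k 1"] by (simp_all add: algebra_simps)
  thus ?case by (simp add: kernel_Suc neighbour_mean_def add.commute)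
qed (simp add: kernel_0)

text \<open>Each mean involves finitely many neighbours, and finite combinations of
  \<open>has_sum\<close> facts are again such facts. So the sum converges for every
  \<open>u\<close>, however fast it grows.\<close>

lemma kernel_convolution:
  "((\<lambda>m. kernel t (n - m) * u m) has_sum (neighbour_mean ^^ t) u n) UNIV"
proof (induction t arbitrary: n)
  case 0
  have "((\<lambda>m. kernel 0 (n - m) * u m) has_sum (\<Sum>m\<in>{n}. kernel 0 (n - m) * u m)) {n}"
    by (intro has_sum_finite) auto
  also have "?this \<longleftrightarrow> ((\<lambda>m. kernel 0 (n - m) * u m) has_sum (\<Sum>m\<in>{n}. kernel 0 (n - m) * u m)) UNIV"
    by (intro has_sum_cong_neutral) (auto simp: kernel_0)
  finally show ?case by (simp add: kernel_0)
next
  case (Suc t)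
  have shift: "n + axis k 1 - m = n - m + axis k 1" "n - axis k 1 - m = n - m - axis k 1" for k m
    by (simp_all add: algebra_simps)
  have "((\<lambda>m. (1 / (2 * real CARD('a))) *
            (\<Sum>k\<in>UNIV. kernel t (n + axis k 1 - m) * u m + kernel t (n - axis k 1 - m) * u m)) has_sum
         neighbour_mean ((neighbour_mean ^^ t) u) n) UNIV"
    unfolding neighbour_mean_def[of "(neighbour_mean ^^ t) u"]
    by (intro has_sum_cmult_right has_sum_finite_sum has_sum_add Suc)
  also have "(\<lambda>m. (1 / (2 * real CARD('a))) *
            (\<Sum>k\<in>UNIV. kernel t (n + axis k 1 - m) * u m + kernel t (n - axis k 1 - m) * u m))
      = (\<lambda>m. kernel (Suc t) (n - m) * u m)"
    unfolding shift by (simp add: kernel_Suc neighbour_mean_def sum_distrib_right distrib_right)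
  finally show ?case by simp
qed

text \<open>Translates of \<open>v\<close> all have the same sum. This conservation of mass leaves
  any growth of mass to the nonlinearity.\<close>

lemma neighbour_mean_has_sum:
  fixes v :: "int ^ 'd \<Rightarrow> real"
  assumes "(v has_sum A) UNIV"
  shows "(neighbour_mean v has_sum A) UNIV"
proof -
  have shift: "((\<lambda>n. v (n + z)) has_sum A) UNIV" for z
  proof -
    have "bij (\<lambda>n. n + z)" by (rule bij_betwI[where g = "\<lambda>n. n - z"]) auto
    from has_sum_reindex_bij_betw[OF this, of v A] assms show ?thesis by simp
  qed
  have "((\<lambda>n. (1 / (2 * real CARD('d))) * (\<Sum>k\<in>UNIV. v (n + axis k 1) + v (n - axis k 1))) has_sum
          (1 / (2 * real CARD('d))) * (\<Sum>k::'d\<in>UNIV. A + A)) UNIV"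
    using shift[of "- axis k 1" for k]
    by (intro has_sum_cmult_right has_sum_finite_sum has_sum_add shift) auto
  thus ?thesis by (simp add: neighbour_mean_def[abs_def])
qed

section \<open>Second moments and Chebyshev's inequality\<close>

definition sq_norm :: "int ^ 'd \<Rightarrow> real" where
  "sq_norm n = (\<Sum>k\<in>UNIV. (real_of_int (n $ k))\<^sup>2)"

lemma sq_norm_nonneg: "0 \<le> sq_norm n"
  by (simp add: sq_norm_def sum_nonneg)

lemma sq_norm_neighbours:
  "sq_norm (n + axis k 1) + sq_norm (n - axis k 1) = 2 * sq_norm n + 2"
proof -
  have "sq_norm (n + axis k 1) + sq_norm (n - axis k 1)
      = (\<Sum>j\<in>UNIV. 2 * (real_of_int (n $ j))\<^sup>2 + (if j = k then 2 else 0))"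
    unfolding sq_norm_def sum.distrib[symmetric]
    by (intro sum.cong) (auto simp: axis_def power2_eq_square algebra_simps)
  thus ?thesis by (simp add: sum.distrib sum_distrib_left sq_norm_def)
qed

lemma neighbour_mean_sq_norm: "neighbour_mean sq_norm n = sq_norm n + 1"
  unfolding neighbour_mean_def sq_norm_neighbours by (simp add: field_simps)

lemma neighbour_mean_funpow_affine_sq_norm:
  fixes m :: "int ^ 'd"
  shows "(neighbour_mean ^^ t) (\<lambda>n. 1 + c * sq_norm n) m = 1 + c * (sq_norm m + real t)"
proof (induction t arbitrary: m)
  case (Suc t)
  have "(neighbour_mean ^^ t) (\<lambda>n. 1 + c * sq_norm n) = (\<lambda>m :: int ^ 'd. (1 + c * real t) + c * sq_norm m)"
    by (simp add: Suc fun_eq_iff algebra_simps)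
  thus ?case
    by (simp add: neighbour_mean_add neighbour_mean_const neighbour_mean_cmult
        neighbour_mean_sq_norm algebra_simps)
qed simp

text \<open>A walk started at \<open>m\<close> with \<open>sq_norm m \<le> t\<close> has second
  moment at most \<open>2 * t\<close> at time \<open>t\<close>; the constant 4 makes Chebyshev lose
  at most half of the mass.\<close>

definition diffusive_ball :: "nat \<Rightarrow> (int ^ 'd) set" where
  "diffusive_ball t = {n. sq_norm n \<le> 4 * real t}"

text \<open>The ball lies in a cube with \<open>2 * r + 1\<close> points per axis, and
  \<open>t \<ge> 1\<close> lets the constant 5 absorb the extra 1.\<close>

lemma diffusive_ball_bound:
  assumes "t \<ge> 1"
  shows "finite (diffusive_ball t :: (int ^ 'd) set)"
    and "real (card (diffusive_ball t :: (int ^ 'd) set)) \<le> (5 * sqrt (real t)) ^ CARD('d)"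
proof -
  define r where "r = \<lfloor>2 * sqrt (real t)\<rfloor>"
  define P where "P = PiE (UNIV :: 'd set) (\<lambda>_. {-r..r})"
  have sub: "(diffusive_ball t :: (int ^ 'd) set) \<subseteq> vec_lambda ` P"
  proof
    fix n :: "int ^ 'd" assume "n \<in> diffusive_ball t"
    hence n: "sq_norm n \<le> 4 * real t" by (simp add: diffusive_ball_def)
    have "n $ k \<in> {-r..r}" for k
    proof -
      have "(real_of_int (n $ k))\<^sup>2 \<le> sq_norm n"
        unfolding sq_norm_def by (rule member_le_sum) auto
      hence "(real_of_int (n $ k))\<^sup>2 \<le> 4 * real t" using n by linarith
      hence "\<bar>real_of_int (n $ k)\<bar> \<le> sqrt (4 * real t)" by (rule real_le_rsqrt[OF order_trans[rotated]]) simp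
      hence "\<bar>real_of_int (n $ k)\<bar> \<le> 2 * sqrt (real t)" by (simp add: real_sqrt_mult)
      hence "\<bar>n $ k\<bar> \<le> r" unfolding r_def by (simp add: le_floor_iff)
      thus ?thesis by auto
    qed
    hence "vec_nth n \<in> P" by (auto simp: P_def)
    thus "n \<in> vec_lambda ` P" by (metis image_eqI vec_nth_inverse)
  qed
  have finP: "finite P" unfolding P_def by (intro finite_PiE) auto
  thus "finite (diffusive_ball t :: (int ^ 'd) set)" using sub by (meson finite_imageI finite_subset)
  have r0: "r \<ge> 0" by (simp add: r_def)
  have "card (diffusive_ball t :: (int ^ 'd) set) \<le> card P"
    using card_mono[OF _ sub] card_image_le[OF finP, of vec_lambda] finP by force
  also have "card P = nat (2 * r + 1) ^ CARD('d)"
    unfolding P_def by (simp add: card_PiE)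
  finally have "real (card (diffusive_ball t :: (int ^ 'd) set)) \<le> real (nat (2 * r + 1) ^ CARD('d))"
    by linarith
  also have "\<dots> = (2 * real_of_int r + 1) ^ CARD('d)" using r0 by simp
  also have "\<dots> \<le> (5 * sqrt (real t)) ^ CARD('d)"
  proof (rule power_mono)
    have "real_of_int r \<le> 2 * sqrt (real t)" by (simp add: r_def)
    moreover have "1 \<le> sqrt (real t)" using assms by simp
    ultimately show "2 * real_of_int r + 1 \<le> 5 * sqrt (real t)" by linarith
  qed (use r0 in simp)
  finally show "real (card (diffusive_ball t :: (int ^ 'd) set)) \<le> (5 * sqrt (real t)) ^ CARD('d)" .
qed

text \<open>Chebyshev's inequality for the walk, read off from the pointwise bound
  \<open>1 - |n|\<^sup>2 / (4 t) \<le> 1\<^sub>Q(n)\<close> and the fact that each step adds 1 to the second moment.\<close>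

lemma neighbour_mean_funpow_ball_ge:
  assumes "t \<ge> 1" "sq_norm m \<le> real t"
  shows "(neighbour_mean ^^ t) (indicator (diffusive_ball t)) m \<ge> (1 / 2 :: real)"
proof -
  define c where "c = - (1 / (4 * real t))"
  have "1 + c * sq_norm n \<le> indicator (diffusive_ball t) n" for n :: "int ^ 'a"
    using assms sq_norm_nonneg[of n]
    by (auto simp: c_def indicator_def diffusive_ball_def field_simps)
  hence "(neighbour_mean ^^ t) (\<lambda>n. 1 + c * sq_norm n) m \<le> (neighbour_mean ^^ t) (indicator (diffusive_ball t)) m"
    by (rule neighbour_mean_funpow_mono)
  moreover have "1 + c * (sq_norm m + real t) \<ge> 1 / 2"
    using assms by (simp add: c_def field_simps)
  ultimately show ?thesis by (simp add: neighbour_mean_funpow_affine_sq_norm)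
qed

text \<open>Duality: the kernel is symmetric, so the \<open>t\<close> means can be moved from
  \<open>u\<close> to the indicator of the ball, where Chebyshev gives at least 1/2 at every point
  of \<open>D\<close>.\<close>

lemma mass_le_mass_in_ball:
  fixes u :: "int ^ 'd \<Rightarrow> real"
  assumes u: "\<And>n. 0 \<le> u n" and t: "t \<ge> 1" and D: "finite D" "\<And>m. m \<in> D \<Longrightarrow> sq_norm m \<le> real t"
  shows "(\<Sum>m\<in>D. u m) \<le> 2 * (\<Sum>n\<in>diffusive_ball t. (neighbour_mean ^^ t) u n)"
proof -
  let ?Q = "diffusive_ball t :: (int ^ 'd) set"
  let ?h = "\<lambda>m. (neighbour_mean ^^ t) (indicator ?Q) m :: real"
  note fin = diffusive_ball_bound(1)[OF t, where ?'d = 'd]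
  have h: "?h m = (\<Sum>n\<in>?Q. kernel t (n - m))" for m
  proof -
    have "((\<lambda>n. kernel t (m - n) * indicator ?Q n) has_sum ?h m) UNIV"
      by (rule kernel_convolution)
    also have "?this \<longleftrightarrow> ((\<lambda>n. kernel t (m - n)) has_sum ?h m) ?Q"
      by (intro has_sum_cong_neutral) auto
    finally have "?h m = (\<Sum>n\<in>?Q. kernel t (m - n))"
      using fin has_sum_finite has_sum_unique by blast
    also have "\<dots> = (\<Sum>n\<in>?Q. kernel t (n - m))"
      by (intro sum.cong refl) (metis kernel_uminus minus_diff_eq)
    finally show ?thesis .
  qed
  have "((\<lambda>m. \<Sum>n\<in>?Q. kernel t (n - m) * u m) has_sum (\<Sum>n\<in>?Q. (neighbour_mean ^^ t) u n)) UNIV"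
    by (intro has_sum_finite_sum kernel_convolution)
  hence S: "((\<lambda>m. ?h m * u m) has_sum (\<Sum>n\<in>?Q. (neighbour_mean ^^ t) u n)) UNIV"
    by (simp add: h sum_distrib_right)
  have "(\<Sum>m\<in>D. u m) / 2 \<le> (\<Sum>m\<in>D. ?h m * u m)"
    unfolding sum_divide_distrib
    using neighbour_mean_funpow_ball_ge[OF t D(2)] u
    by (intro sum_mono) (metis mult.commute mult_left_mono times_divide_eq_right mult.right_neutral)
  also have "\<dots> \<le> (\<Sum>n\<in>?Q. (neighbour_mean ^^ t) u n)"
  proof (rule has_sum_mono2[OF has_sum_finite[OF D(1)] S])
    show "0 \<le> ?h m * u m" for m
      by (intro mult_nonneg_nonneg u neighbour_mean_funpow_nonneg) auto
  qed auto
  finally show ?thesis by simp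
qed

subsection \<open>Blow-up\<close>

text \<open>For \<open>x > 0\<close> this is \<open>(x\<^bsup>-\<alpha>\<^esup> + s)\<^bsup>-1/\<alpha>\<^esup>\<close>, in a form that has the right value at \<open>x = 0\<close> too.\<close>

definition kappa :: "real \<Rightarrow> real \<Rightarrow> real \<Rightarrow> real" where
  "kappa \<alpha> s x = x / (1 + s * x powr \<alpha>) powr (1 / \<alpha>)"

lemma kappa_0 [simp]: "kappa \<alpha> s 0 = 0" "x \<ge> 0 \<Longrightarrow> kappa \<alpha> 0 x = x"
  by (auto simp: kappa_def)

text \<open>Dropping the 1 in the denominator leaves a bound independent of
  \<open>x\<close>.\<close>

lemma kappa_less:
  assumes "\<alpha> > 0" "s > 0" "x \<ge> 0"
  shows "kappa \<alpha> s x < s powr (- (1 / \<alpha>))"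
proof (cases "x = 0")
  case False
  hence x: "x > 0" using assms by simp
  have "(s * x powr \<alpha>) powr (1 / \<alpha>) < (1 + s * x powr \<alpha>) powr (1 / \<alpha>)"
    using assms x by (intro powr_less_mono2) auto
  moreover have "(s * x powr \<alpha>) powr (1 / \<alpha>) = s powr (1 / \<alpha>) * x"
    using assms x by (simp add: powr_mult powr_powr)
  ultimately have "s powr (1 / \<alpha>) * x < (1 + s * x powr \<alpha>) powr (1 / \<alpha>)" by simp
  moreover have "(1 + s * x powr \<alpha>) powr (1 / \<alpha>) > 0" using assms x
    by (smt (verit) mult_pos_pos powr_gt_zero)
  ultimately show ?thesis using assms
    by (simp add: kappa_def powr_minus field_simps)
qed (use assms in auto)

text \<open>One step of the recursion subtracts 1 from the power -\<alpha> of \<open>g\<close>;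
  raising \<open>s\<close> by 1 adds it back.\<close>

lemma kappa_Suc:
  assumes "\<alpha> > 0" "s \<ge> 0" "0 \<le> g" "g < 1"
  shows "kappa \<alpha> (s + 1) (g / (1 - g powr \<alpha>) powr (1 / \<alpha>)) = kappa \<alpha> s g"
proof (cases "g = 0")
  case False
  hence g: "g > 0" using assms by simp
  define w where "w = 1 - g powr \<alpha>"
  have w: "w > 0" unfolding w_def using powr_less_mono2[of \<alpha> g 1] assms by simp
  have gw: "g powr \<alpha> = 1 - w" by (simp add: w_def)
  have pw: "(g / w powr (1 / \<alpha>)) powr \<alpha> = (1 - w) / w"
    using assms w g by (simp add: powr_divide powr_powr gw)
  have eq: "1 + (s + 1) * (g / w powr (1 / \<alpha>)) powr \<alpha> = (1 + s * g powr \<alpha>) / w"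
    unfolding pw gw using w by (simp add: field_simps)
  have p: "1 + s * g powr \<alpha> > 0" using assms by (simp add: add_pos_nonneg)
  show ?thesis unfolding kappa_def w_def[symmetric] eq using w p
    by (simp add: powr_divide)
qed simp

text \<open>Concavity in tangent form: the slope is decreasing on the positive reals. The point 0,
  where \<open>powr\<close> need not be differentiable, is checked by hand: the tangent is
  nonnegative there.\<close>

lemma kappa_tangent:
  assumes "\<alpha> > 0" "s \<ge> 0" "0 \<le> x" "0 < m"
  shows "kappa \<alpha> s x \<le> kappa \<alpha> s m + (1 + s * m powr \<alpha>) powr (- (1 / \<alpha>) - 1) * (x - m)"
proof (cases "x = 0")
  case True
  let ?p = "1 + s * m powr \<alpha>"
  have p: "?p \<ge> 1" using assms by simp
  have "?p powr (- (1 / \<alpha>) - 1) \<le> ?p powr (- (1 / \<alpha>))" using p by (intro powr_mono) auto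
  hence "?p powr (- (1 / \<alpha>) - 1) * m \<le> ?p powr (- (1 / \<alpha>)) * m" using assms by (intro mult_right_mono) auto
  also have "\<dots> = kappa \<alpha> s m" by (simp add: kappa_def powr_minus divide_simps)
  finally show ?thesis using True by simp
next
  case False
  hence x: "x > 0" using assms by simp
  let ?k = "\<lambda>x. - kappa \<alpha> s x"
  let ?k' = "\<lambda>x. - ((1 + s * x powr \<alpha>) powr (- (1 / \<alpha>) - 1))"
  have d: "(?k has_real_derivative ?k' z) (at z)" if z: "z > 0" for z
  proof -
    let ?p = "1 + s * z powr \<alpha>"
    have p: "?p > 0" using assms by (simp add: add_pos_nonneg)
    let ?P = "?p powr (- (1 / \<alpha>) - 1)"
    have "((\<lambda>x. 1 + s * x powr \<alpha>) has_real_derivative s * (\<alpha> * z powr (\<alpha> - 1))) (at z)"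
      using z by (auto intro!: derivative_eq_intros has_real_derivative_powr)
    from DERIV_chain2[OF has_real_derivative_powr[OF p] this]
    have "((\<lambda>x. (1 + s * x powr \<alpha>) powr (- (1 / \<alpha>))) has_real_derivative
        - (1 / \<alpha>) * ?P * (s * (\<alpha> * z powr (\<alpha> - 1)))) (at z)" .
    from DERIV_minus[OF DERIV_mult[OF DERIV_ident this]]
    have "((\<lambda>x. - (x * (1 + s * x powr \<alpha>) powr (- (1 / \<alpha>)))) has_real_derivative
           - (1 * ?p powr (- (1 / \<alpha>)) + (- (1 / \<alpha>) * ?P * (s * (\<alpha> * z powr (\<alpha> - 1)))) * z)) (at z)" .
    \<comment> \<open>With the common factor \<open>?P\<close> taken out, the product rule leaves
      \<open>?p - s * z powr \<alpha> = 1\<close>, so the derivative collapses to the claimed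
      slope.\<close>
    also have "?p powr (- (1 / \<alpha>)) = ?P * ?p" using p by (simp add: powr_diff)
    also have "1 * (?P * ?p) + (- (1 / \<alpha>) * ?P * (s * (\<alpha> * z powr (\<alpha> - 1)))) * z
        = ?P * (?p - s * (z powr (\<alpha> - 1) * z))"
      using assms by (simp add: field_simps)
    also have "z powr (\<alpha> - 1) * z = z powr \<alpha>" using z by (simp add: powr_diff)
    finally show ?thesis
      by (simp add: kappa_def[abs_def] powr_minus divide_inverse)
  qed
  have cvx: "convex_on {0<..} ?k"
  proof (rule convex_on_realI)
    show "connected {0::real<..}" by (simp add: connected_Ioi)
    show "?k' x \<le> ?k' y" if "x \<in> {0<..}" "y \<in> {0<..}" "x \<le> y" for x y
    proof -
      have "x powr \<alpha> \<le> y powr \<alpha>" using that assms by (intro powr_mono2) auto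
      hence "s * x powr \<alpha> \<le> s * y powr \<alpha>" using assms by (intro mult_left_mono) auto
      moreover have "- (1 / \<alpha>) - 1 \<le> 0" using assms by (simp add: field_simps)
      ultimately show ?thesis using assms by (auto intro!: powr_mono2' add_pos_nonneg)
    qed
  qed (use d in auto)
  have "?k' m * (x - m) \<le> ?k x - ?k m"
    using assms x
    by (intro convex_on_imp_above_tangent[OF cvx]) 
       (auto simp: interior_open intro: has_field_derivative_at_within d)
  thus ?thesis by simp
qed

text \<open>Jensen's inequality: average the tangent bound taken at the mean. If the mean is 0,
  there is no tangent, but then all neighbours vanish.\<close>

lemma neighbour_mean_kappa_le:
  fixes u :: "int ^ 'd \<Rightarrow> real"
  assumes "\<alpha> > 0" "s \<ge> 0" "\<And>n. 0 \<le> u n"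
  shows "neighbour_mean (\<lambda>n. kappa \<alpha> s (u n)) n \<le> kappa \<alpha> s (neighbour_mean u n)"
proof (cases "neighbour_mean u n = 0")
  case True
  show ?thesis using neighbour_mean_eq_0[OF assms(3) True] True
    by (simp add: neighbour_mean_def)
next
  case False
  define m where "m = neighbour_mean u n"
  define c where "c = (1 + s * m powr \<alpha>) powr (- (1 / \<alpha>) - 1)"
  have m: "m > 0" using False neighbour_mean_nonneg[of u n, OF assms(3)] by (simp add: m_def)
  have "neighbour_mean (\<lambda>n. kappa \<alpha> s (u n)) n \<le> neighbour_mean (\<lambda>n. (kappa \<alpha> s m - c * m) + c * u n) n"
    using kappa_tangent[OF assms(1,2,3) m]
    by (intro neighbour_mean_mono) (simp add: c_def algebra_simps)
  also have "\<dots> = kappa \<alpha> s m"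
    by (simp add: neighbour_mean_add neighbour_mean_const neighbour_mean_cmult m_def[symmetric])
  finally show ?thesis by (simp add: m_def)
qed

section \<open>Bounds on global solutions and the subcritical case\<close>

lemma global_solutionD:
  assumes "global_solution \<alpha> a f"
  shows "f 0 = a" "0 \<le> f t n" "0 \<le> neighbour_mean (f t) n" "neighbour_mean (f t) n < 1"
    "f (Suc t) n = neighbour_mean (f t) n / (1 - neighbour_mean (f t) n powr \<alpha>) powr (1 / \<alpha>)"
  using assms by (auto simp: global_solution_def solves_ivp_def Let_def intro: neighbour_mean_nonneg)

lemma global_solution_shift:
  "global_solution \<alpha> a f \<Longrightarrow> global_solution \<alpha> (f s) (\<lambda>t. f (s + t))"
  by (auto simp: global_solution_def solves_ivp_def Let_def)

text \<open>In the induction, Jensen pulls \<open>kappa\<close> out of the mean, and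
  \<open>kappa_Suc\<close> then trades the unit of time for a step of the recursion.\<close>

lemma neighbour_mean_funpow_le_kappa:
  assumes "\<alpha> > 0" and f: "global_solution \<alpha> a f"
  shows "(neighbour_mean ^^ t) a n \<le> kappa \<alpha> (real t) (f t n)"
proof (induction t arbitrary: n)
  case 0
  show ?case using global_solutionD[OF f] by auto
next
  case (Suc t)
  note g = global_solutionD[OF f]
  have "(neighbour_mean ^^ Suc t) a n \<le> neighbour_mean (\<lambda>n. kappa \<alpha> (real t) (f t n)) n"
    by (simp add: neighbour_mean_mono Suc)
  also have "\<dots> \<le> kappa \<alpha> (real t) (neighbour_mean (f t) n)"
    by (intro neighbour_mean_kappa_le assms g) auto
  also have "\<dots> = kappa \<alpha> (real t + 1) (f (Suc t) n)"
    unfolding g(5) using assms g by (intro kappa_Suc[symmetric]) auto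
  finally show ?case by (simp add: add.commute)
qed

lemma neighbour_mean_funpow_less:
  assumes "\<alpha> > 0" "global_solution \<alpha> a f" "t \<ge> 1"
  shows "(neighbour_mean ^^ t) a n < real t powr (- (1 / \<alpha>))"
  using neighbour_mean_funpow_le_kappa[OF assms(1,2), of t n]
    kappa_less[OF assms(1), of "real t" "f t n"] assms(3) global_solutionD(2)[OF assms(2), of t n]
  by simp

lemma sqrt_power_eq: "t \<ge> 0 \<Longrightarrow> d > 0 \<Longrightarrow> (c * sqrt t) ^ d = c ^ d * t powr (real d / 2)" for c t :: real
  by (cases "t = 0")
     (auto simp: power_mult_distrib powr_half_sqrt[symmetric] powr_powr simp flip: powr_realpow)

text \<open>Once \<open>t\<close> is large enough for \<open>D\<close>, the ball holds at least half
  of its mass, on at most \<open>(5 * sqrt t) ^ d\<close> points with values below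
  \<open>t powr (- (1 / \<alpha>))\<close>. Working with finite \<open>D\<close> requires no
  summability of \<open>a\<close>.\<close>

lemma finite_mass_le:
  fixes a :: "int ^ 'd \<Rightarrow> real"
  assumes \<alpha>: "\<alpha> > 0" and f: "global_solution \<alpha> a f" and D: "finite D"
  shows "\<forall>\<^sub>F t in sequentially. (\<Sum>m\<in>D. a m) \<le> 2 * 5 ^ CARD('d) * real t powr (real CARD('d) / 2 - 1 / \<alpha>)"
proof -
  have "\<forall>\<^sub>F t in sequentially. sq_norm m \<le> real t" for m :: "int ^ 'd"
    using filterlim_real_sequentially by (simp add: filterlim_at_top)
  hence "\<forall>\<^sub>F t in sequentially. \<forall>m\<in>D. sq_norm m \<le> real t"
    using D by (simp add: eventually_ball_finite)
  thus ?thesis using eventually_ge_at_top[of 1]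
  proof eventually_elim
    case (elim t)
    let ?Q = "diffusive_ball t :: (int ^ 'd) set"
    have a: "0 \<le> a n" for n using global_solutionD(1,2)[OF f] by metis
    have "(\<Sum>m\<in>D. a m) \<le> 2 * (\<Sum>n\<in>?Q. (neighbour_mean ^^ t) a n)"
      using elim by (intro mass_le_mass_in_ball a D) auto
    also have "(\<Sum>n\<in>?Q. (neighbour_mean ^^ t) a n) \<le> real (card ?Q) * real t powr (- (1 / \<alpha>))"
      using neighbour_mean_funpow_less[OF \<alpha> f elim(2)] by (intro sum_bounded_above less_imp_le)
    also have "\<dots> \<le> (5 * sqrt (real t)) ^ CARD('d) * real t powr (- (1 / \<alpha>))"
      by (intro mult_right_mono diffusive_ball_bound elim) auto
    also have "\<dots> = 5 ^ CARD('d) * real t powr (real CARD('d) / 2 - 1 / \<alpha>)"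
      by (subst sqrt_power_eq) (auto simp: powr_add[symmetric])
    finally show ?case by simp
  qed
qed

text \<open>The exponent in \<open>finite_mass_le\<close> is negative here, so the bound on the mass
  of \<open>{n}\<close> tends to 0.\<close>

lemma no_global_solution_subcritical:
  fixes a :: "int ^ 'd \<Rightarrow> real"
  assumes \<alpha>: "\<alpha> > 0" "\<alpha> < 2 / real CARD('d)" and n: "a n \<noteq> 0" and f: "global_solution \<alpha> a f"
  shows False
proof -
  define p where "p = real CARD('d) / 2 - 1 / \<alpha>"
  have p: "p < 0" using \<alpha> by (simp add: p_def field_simps)
  have "0 \<le> a n" using global_solutionD(1,2)[OF f] by metis
  have "((\<lambda>t. 2 * 5 ^ CARD('d) * real t powr p) \<longlonglongrightarrow> 2 * 5 ^ CARD('d) * 0)"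
    by (intro tendsto_mult tendsto_const tendsto_neg_powr[OF p] filterlim_real_sequentially)
  moreover have "\<forall>\<^sub>F t in sequentially. a n \<le> 2 * 5 ^ CARD('d) * real t powr p"
    using finite_mass_le[OF \<alpha>(1) f, of "{n}"] by (simp add: p_def)
  ultimately have "a n \<le> 2 * 5 ^ CARD('d) * 0"
    by (intro tendsto_lowerbound[of _ _ sequentially]) auto
  with \<open>0 \<le> a n\<close> n show False by simp
qed

section \<open>The critical case\<close>

text \<open>Two tangent inequalities, \<open>ln w \<le> w - 1\<close> and
  \<open>exp y \<ge> 1 + y\<close>, applied to the power written as an exponential.\<close>

lemma nonlinearity_ge:
  fixes \<alpha> g :: real
  assumes "\<alpha> > 0" "0 \<le> g" "g < 1"
  shows "g + g * g powr \<alpha> / \<alpha> \<le> g / (1 - g powr \<alpha>) powr (1 / \<alpha>)"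
proof -
  have w: "1 - g powr \<alpha> > 0" using powr_less_mono2[of \<alpha> g 1] assms by simp
  have "1 + g powr \<alpha> / \<alpha> \<le> 1 + - (1 / \<alpha>) * ln (1 - g powr \<alpha>)"
    using ln_le_minus_one[OF w] assms by (simp add: divide_simps)
  also have "\<dots> \<le> exp (- (1 / \<alpha>) * ln (1 - g powr \<alpha>))" by (rule exp_ge_add_one_self)
  also have "\<dots> = (1 - g powr \<alpha>) powr (- (1 / \<alpha>))" using w by (simp add: powr_def)
  finally have "g * (1 + g powr \<alpha> / \<alpha>) \<le> g * (1 - g powr \<alpha>) powr (- (1 / \<alpha>))"
    using assms by (intro mult_left_mono)
  thus ?thesis by (simp add: powr_minus divide_inverse algebra_simps)
qed

text \<open>Cut at \<open>c = A / (2 * V)\<close>: subtracting \<open>c\<close> at all points of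
  \<open>Q\<close> costs at most half of \<open>A\<close>, and pointwise
  \<open>(g - c) * c powr \<alpha>\<close> is at most \<open>g * g powr \<alpha>\<close>, being
  nonpositive where \<open>g < c\<close>.\<close>

lemma sum_powr_ge:
  fixes g :: "'a \<Rightarrow> real"
  assumes "\<alpha> > 0" "A \<ge> 0" "V > 0" "\<And>n. n \<in> Q \<Longrightarrow> 0 \<le> g n" "real (card Q) \<le> V" "A \<le> (\<Sum>n\<in>Q. g n)"
  shows "(A / 2) * (A / (2 * V)) powr \<alpha> \<le> (\<Sum>n\<in>Q. g n * g n powr \<alpha>)"
proof -
  define c where "c = A / (2 * V)"
  have c: "c \<ge> 0" using assms by (simp add: c_def)
  have "real (card Q) * c \<le> V * c" using assms c by (intro mult_right_mono)
  also have "V * c = A / 2" using assms by (simp add: c_def)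
  finally have "A / 2 \<le> (\<Sum>n\<in>Q. g n) - real (card Q) * c" using assms by simp
  also have "\<dots> = (\<Sum>n\<in>Q. g n - c)" by (simp add: sum_subtractf)
  finally have "(A / 2) * c powr \<alpha> \<le> (\<Sum>n\<in>Q. g n - c) * c powr \<alpha>" by (intro mult_right_mono) auto
  also have "\<dots> = (\<Sum>n\<in>Q. (g n - c) * c powr \<alpha>)" by (simp add: sum_distrib_right)
  also have "\<dots> \<le> (\<Sum>n\<in>Q. g n * g n powr \<alpha>)"
  proof (rule sum_mono)
    fix n assume n: "n \<in> Q"
    show "(g n - c) * c powr \<alpha> \<le> g n * g n powr \<alpha>"
    proof (cases "c \<le> g n")
      case True
      thus ?thesis using c assms n by (intro mult_mono powr_mono2) auto
    next
      case False
      hence "(g n - c) * c powr \<alpha> \<le> 0" by (simp add: mult_nonpos_nonneg)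
      also have "0 \<le> g n * g n powr \<alpha>" using assms n by simp
      finally show ?thesis .
    qed
  qed
  finally show ?thesis by (simp add: c_def)
qed

lemma neighbour_mean_funpow_le_solution:
  assumes "\<alpha> > 0" and f: "global_solution \<alpha> a f"
  shows "(neighbour_mean ^^ t) a n \<le> f t n"
proof (induction t arbitrary: n)
  case (Suc t)
  let ?g = "neighbour_mean (f t) n"
  note g = global_solutionD[OF f]
  have "(neighbour_mean ^^ Suc t) a n \<le> ?g" by (simp add: neighbour_mean_mono Suc)
  also have "\<dots> \<le> ?g + ?g * ?g powr \<alpha> / \<alpha>" using assms g by simp
  also have "\<dots> \<le> f (Suc t) n" unfolding g(5) using assms g by (intro nonlinearity_ge) auto
  finally show ?case .
qed (use global_solutionD[OF f] in auto)

lemma no_global_solution_critical: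
  fixes a :: "int ^ 'd \<Rightarrow> real"
  assumes \<alpha>: "\<alpha> = 2 / real CARD('d)" and n: "a n \<noteq> 0" and f: "global_solution \<alpha> a f"
  shows False
proof -
  note g = global_solutionD[OF f]
  define K where "K = (2 * 5 ^ CARD('d) :: real)"
  define S where "S t = (\<Sum>\<^sub>\<infinity>m. f t m)" for t
  have \<alpha>0: "\<alpha> > 0" using \<alpha> by simp
  have a: "a n > 0" using g(1,2) n by (metis order_le_less)
  have fin: "(\<Sum>m\<in>D. f t m) \<le> K" if "finite D" for D t
  proof -
    have "\<forall>\<^sub>F s in sequentially. (\<Sum>m\<in>D. f t m) \<le> K * real s powr (real CARD('d) / 2 - 1 / \<alpha>)"
      unfolding K_def by (rule finite_mass_le[OF \<alpha>0 global_solution_shift[OF f] that])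
    \<comment> \<open>At the critical \<alpha> the exponent is 0. The time \<open>s = 0\<close> is
      excluded because \<open>0 powr 0 = 0\<close>.\<close>
    hence "\<forall>\<^sub>F s in sequentially. (\<Sum>m\<in>D. f t m) \<le> K"
      using eventually_gt_at_top[of 0] by eventually_elim (simp add: \<alpha>)
    thus ?thesis by simp
  qed
  have summ: "f t summable_on UNIV" for t
    using g(2) fin by (intro nonneg_bounded_partial_sums_imp_summable_on[where C = K])
      (auto intro!: eventually_finite_subsets_at_top_weakI)
  have S: "(f t has_sum S t) UNIV" for t unfolding S_def using summ by (rule has_sum_infsum)
  have SK: "S t \<le> K" for t unfolding S_def by (intro infsum_le_finite_sums summ fin)
  \<comment> \<open>The outcome of \<open>sum_powr_ge\<close> with \<open>A = a n / 2\<close> and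
    \<open>V powr \<alpha> = 25 * (t + 1)\<close>, divided by \<alpha>.\<close>
  define c where "c = a n / 4 * (a n / 4) powr \<alpha> / (25 * \<alpha>)"
  have c: "c > 0" using a \<alpha>0 by (simp add: c_def)
  have step: "S t + c / real (Suc t) \<le> S (Suc t)" if t: "sq_norm n \<le> real t" for t
  proof -
    let ?Q = "diffusive_ball (Suc t) :: (int ^ 'd) set"
    let ?g = "neighbour_mean (f t)"
    define V where "V = (5 * sqrt (real (Suc t))) ^ CARD('d)"
    have V: "V > 0" by (simp add: V_def)
    note ball = diffusive_ball_bound[of "Suc t", where ?'d = 'd, simplified]
    have "a n = (\<Sum>m\<in>{n}. a m)" by simp
    also have "\<dots> \<le> 2 * (\<Sum>m\<in>?Q. (neighbour_mean ^^ Suc t) a m)"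
      using t g(2)[of 0] by (intro mass_le_mass_in_ball) (auto simp: g(1))
    also have "(\<Sum>m\<in>?Q. (neighbour_mean ^^ Suc t) a m) \<le> (\<Sum>m\<in>?Q. ?g m)"
      by (intro sum_mono) (simp add: neighbour_mean_mono neighbour_mean_funpow_le_solution[OF \<alpha>0 f])
    finally have "a n / 2 \<le> (\<Sum>m\<in>?Q. ?g m)" by simp
    hence s1: "(a n / 2 / 2) * (a n / 2 / (2 * V)) powr \<alpha> \<le> (\<Sum>m\<in>?Q. ?g m * ?g m powr \<alpha>)"
      using \<alpha>0 a V ball(2) g(3) by (intro sum_powr_ge) (auto simp: V_def)
    \<comment> \<open>Criticality enters here: \<alpha> times the dimension is 2, so the gain is of
      order 1/t, just enough to diverge.\<close>
    have V\<alpha>: "V powr \<alpha> = 25 * real (Suc t)"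
    proof -
      have "V = (5 * sqrt (real (Suc t))) powr real CARD('d)" by (simp add: V_def powr_realpow)
      hence "V powr \<alpha> = (5 * sqrt (real (Suc t))) powr 2" using \<alpha> by (simp add: powr_powr)
      also have "\<dots> = 25 * real (Suc t)" by (simp add: power_mult_distrib)
      finally show ?thesis .
    qed
    have "(a n / 2 / 2) * (a n / 2 / (2 * V)) powr \<alpha> = a n / 4 * ((a n / 4) powr \<alpha> / V powr \<alpha>)"
      by (simp add: powr_divide[symmetric])
    also have "\<dots> = c * \<alpha> / real (Suc t)"
      unfolding V\<alpha> using \<alpha>0 by (simp add: c_def del: of_nat_Suc)
    finally have low: "c * \<alpha> / real (Suc t) \<le> (\<Sum>m\<in>?Q. ?g m * ?g m powr \<alpha>)"
      using s1 by (rule subst)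
    \<comment> \<open>Only the gain inside the ball is kept, so that it is a finite sum; outside,
      the nonlinearity is bounded below by the mean alone.\<close>
    have "((\<lambda>m. ?g m * ?g m powr \<alpha> / \<alpha>) has_sum (\<Sum>m\<in>?Q. ?g m * ?g m powr \<alpha> / \<alpha>)) ?Q"
      by (rule has_sum_finite[OF ball(1)])
    also have "?this \<longleftrightarrow> ((\<lambda>m. if m \<in> ?Q then ?g m * ?g m powr \<alpha> / \<alpha> else 0) has_sum
        (\<Sum>m\<in>?Q. ?g m * ?g m powr \<alpha> / \<alpha>)) UNIV"
      by (intro has_sum_cong_neutral) auto
    finally have "((\<lambda>m. if m \<in> ?Q then ?g m * ?g m powr \<alpha> / \<alpha> else 0) has_sum
        (\<Sum>m\<in>?Q. ?g m * ?g m powr \<alpha> / \<alpha>)) UNIV" .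
    from has_sum_add[OF neighbour_mean_has_sum[OF S] this]
    have "((\<lambda>m. ?g m + (if m \<in> ?Q then ?g m * ?g m powr \<alpha> / \<alpha> else 0)) has_sum
            (S t + (\<Sum>m\<in>?Q. ?g m * ?g m powr \<alpha> / \<alpha>))) UNIV" .
    hence "S t + (\<Sum>m\<in>?Q. ?g m * ?g m powr \<alpha> / \<alpha>) \<le> S (Suc t)"
    proof (rule has_sum_mono[OF _ S])
      fix m :: "int ^ 'd"
      have "?g m + (if m \<in> ?Q then ?g m * ?g m powr \<alpha> / \<alpha> else 0) \<le> ?g m + ?g m * ?g m powr \<alpha> / \<alpha>"
        using g(3)[of t m] \<alpha>0 by simp
      also have "\<dots> \<le> f (Suc t) m" unfolding g(5) using \<alpha>0 g by (intro nonlinearity_ge) auto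
      finally show "?g m + (if m \<in> ?Q then ?g m * ?g m powr \<alpha> / \<alpha> else 0) \<le> f (Suc t) m" .
    qed
    moreover have "c / real (Suc t) \<le> (\<Sum>m\<in>?Q. ?g m * ?g m powr \<alpha> / \<alpha>)"
      using low \<alpha>0 by (simp add: sum_divide_distrib[symmetric] field_simps)
    ultimately show ?thesis by linarith
  qed
  obtain t0 :: nat where t0: "sq_norm n \<le> real t0" using real_arch_simple by blast
  have acc: "S t0 + (\<Sum>j<k. c / real (Suc (j + t0))) \<le> S (t0 + k)" for k
  proof (induction k)
    case (Suc k)
    have "S (t0 + k) + c / real (Suc (t0 + k)) \<le> S (Suc (t0 + k))"
      using t0 by (intro step) simp
    thus ?case using Suc by (simp add: add.commute)
  qed simp
  have "summable (\<lambda>j. c / real (Suc (j + t0)))"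
  proof (rule summableI_nonneg_bounded[where x = K])
    show "(\<Sum>j<k. c / real (Suc (j + t0))) \<le> K" for k
      using acc[of k] SK[of "t0 + k"] infsum_nonneg[of UNIV "f t0"] g(2) by (simp add: S_def)
  qed (use c in auto)
  hence "summable (\<lambda>j. 1 / c * (c / real (Suc (j + t0))))" by (rule summable_mult)
  hence "summable (\<lambda>j. 1 / real (Suc (j + t0)))" using c by simp
  hence "summable (\<lambda>j. 1 / real (Suc j))" using summable_iff_shift[of "\<lambda>j. 1 / real (Suc j)" t0] by simp
  thus False using not_summable_harmonic[where 'a = real] summable_Suc_iff[of "\<lambda>j. 1 / real j"]
    by (simp add: inverse_eq_divide)
qed

subsection \<open>The heat kernel bound\<close>

fun walk1 :: "nat \<Rightarrow> int \<Rightarrow> real" where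
  "walk1 0 x = (if x = 0 then 1 else 0)"
| "walk1 (Suc m) x = (walk1 m (x + 1) + walk1 m (x - 1)) / 2"

lemma walk1_eq_0: "(\<And>j::nat. x \<noteq> 2 * int j - int m) \<Longrightarrow> walk1 m x = 0"
proof (induction m arbitrary: x)
  case 0
  show ?case using 0[of 0] by simp
next
  case (Suc m)
  have "x + 1 \<noteq> 2 * int j - int m" for j using Suc.prems[of j] by simp
  moreover have "x - 1 \<noteq> 2 * int j - int m" for j using Suc.prems[of "Suc j"] by simp
  ultimately show ?case using Suc.IH by simp
qed

text \<open>Position \<open>2 * j - m\<close> means \<open>j\<close> upward steps among
  \<open>m\<close>, and the recursion is Pascal's rule. For \<open>j > m\<close> both sides
  vanish.\<close>

lemma walk1_binomial: "walk1 m (2 * int j - int m) = real (m choose j) / 2 ^ m"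
proof (induction m arbitrary: j)
  case 0
  show ?case by (cases j) auto
next
  case (Suc m)
  have plus: "walk1 m (2 * int j - int (Suc m) + 1) = real (m choose j) / 2 ^ m"
    using Suc[of j] by simp
  show ?case
  proof (cases j)
    case 0
    have "walk1 m (2 * int j - int (Suc m) - 1) = 0" by (rule walk1_eq_0) (use 0 in auto)
    thus ?thesis using plus 0 by simp
  next
    case (Suc i)
    have "2 * int j - int (Suc m) - 1 = 2 * int i - int m" using Suc by simp
    thus ?thesis using plus Suc.IH[of i] Suc by (simp add: field_simps)
  qed
qed

text \<open>Consecutive central coefficients have ratio \<open>2 * (2 * k + 1) / (k + 1)\<close>;
  the induction closes because the geometric mean of \<open>2 * k + 1\<close> and
  \<open>2 * k + 3\<close> is at most \<open>2 * k + 2\<close>.\<close>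

lemma central_binomial_upper: "real ((2 * k) choose k) * sqrt (real (2 * k + 1)) \<le> 4 ^ k"
proof (induction k)
  case (Suc k)
  have rec: "real (Suc k) * real ((2 * Suc k) choose (Suc k)) = 2 * real (2 * k + 1) * real ((2 * k) choose k)"
  proof -
    have "Suc k * ((2 * Suc k) choose (Suc k)) = (2 * Suc k) * ((2 * k + 1) choose k)"
      using Suc_times_binomial_eq[of "2 * k + 1" k] by (simp add: mult.commute)
    moreover have "Suc k * ((2 * k + 1) choose k) = (2 * k + 1) * ((2 * k) choose k)"
      using binomial_absorb_comp[of "2 * k + 1" k] by simp
    ultimately have "Suc k * (Suc k * ((2 * Suc k) choose (Suc k))) = Suc k * (2 * ((2 * k + 1) * ((2 * k) choose k)))"
      by (metis mult.assoc mult.commute)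
    hence "Suc k * ((2 * Suc k) choose (Suc k)) = 2 * ((2 * k + 1) * ((2 * k) choose k))"
      by (metis mult_cancel1 nat.distinct(1))
    from arg_cong[OF this, of real] show ?thesis by (simp only: of_nat_mult of_nat_numeral mult.assoc)
  qed
  have s: "sqrt (real (2 * k + 1)) * sqrt (real (2 * Suc k + 1)) \<le> 2 * real (Suc k)"
    by (simp add: real_sqrt_mult[symmetric], rule real_le_lsqrt) (auto simp: power2_eq_square algebra_simps)
  have "real (Suc k) * (real ((2 * Suc k) choose (Suc k)) * sqrt (real (2 * Suc k + 1)))
      = 2 * (real ((2 * k) choose k) * sqrt (real (2 * k + 1))) * (sqrt (real (2 * k + 1)) * sqrt (real (2 * Suc k + 1)))"
    using rec by (simp add: mult.assoc[symmetric])
  also have "\<dots> \<le> 2 * 4 ^ k * (2 * real (Suc k))"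
    by (rule mult_mono[OF mult_left_mono[OF Suc.IH] s]) auto
  also have "2 * 4 ^ k * (2 * real (Suc k)) = real (Suc k) * 4 ^ Suc k" by simp
  finally show ?case by (rule mult_left_le_imp_le) simp
qed simp

text \<open>For odd \<open>m\<close>, twice the middle coefficient is the central coefficient of
  \<open>m + 1\<close>, so the even case suffices.\<close>

lemma binomial_upper: "real (m choose j) * sqrt (real (m + 1)) \<le> 2 ^ m"
proof (cases "even m")
  case True
  then obtain k where k: "m = 2 * k" by blast
  have "real (m choose j) * sqrt (real (m + 1)) \<le> real ((2 * k) choose k) * sqrt (real (m + 1))"
    using binomial_maximum[of m j] k by (intro mult_right_mono) auto
  also have "\<dots> \<le> 4 ^ k" using central_binomial_upper[of k] k by simp
  finally show ?thesis using k by (simp add: power_mult)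
next
  case False
  then obtain k where k: "m = 2 * k + 1" by (metis oddE)
  have "2 * (m choose k) = (2 * Suc k) choose Suc k"
    using k binomial_symmetric[of k m] by simp
  hence two: "2 * real (m choose k) = real ((2 * Suc k) choose Suc k)" by (metis of_nat_mult of_nat_numeral)
  have "2 * (real (m choose j) * sqrt (real (m + 1))) \<le> 2 * (real (m choose k) * sqrt (real (2 * Suc k + 1)))"
    using binomial_maximum[of m j] k by (intro mult_left_mono mult_mono) auto
  also have "\<dots> = real ((2 * Suc k) choose Suc k) * sqrt (real (2 * Suc k + 1))" using two by simp
  also have "\<dots> \<le> 4 ^ Suc k" by (rule central_binomial_upper)
  also have "\<dots> = 2 * 2 ^ m" using k by (simp add: power_mult)
  finally show ?thesis by simp
qed

lemma walk1_nonneg: "0 \<le> walk1 m x"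
  by (induction m arbitrary: x) auto

text \<open>Stated for the square because the mean of \<open>1 / (N k + 1)\<close> over step counts
  is accessible by size biasing, without square roots.\<close>

lemma walk1_sq_le: "(walk1 m x)\<^sup>2 \<le> 1 / real (m + 1)"
proof (cases "\<exists>j::nat. x = 2 * int j - int m")
  case True
  then obtain j :: nat where j: "x = 2 * int j - int m" by blast
  have "walk1 m x * sqrt (real (m + 1)) \<le> 1"
    unfolding j walk1_binomial using binomial_upper[of m j] by (simp add: field_simps)
  hence "(walk1 m x * sqrt (real (m + 1)))\<^sup>2 \<le> 1"
    using walk1_nonneg[of m x] by (intro power_le_one) auto
  thus ?thesis by (simp add: power_mult_distrib field_simps)
next
  case False
  hence "walk1 m x = 0" by (intro walk1_eq_0) auto
  thus ?thesis by simp
qed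

text \<open>Expectation with respect to the multinomial law: \<open>N k\<close> counts the steps in direction \<open>k\<close>
  among the first \<open>t\<close> steps of the walk.\<close>

fun step_count_mean :: "nat \<Rightarrow> (('d::finite \<Rightarrow> nat) \<Rightarrow> real) \<Rightarrow> real" where
  "step_count_mean 0 F = F (\<lambda>_. 0)"
| "step_count_mean (Suc t) F =
     (\<Sum>k\<in>UNIV. step_count_mean t (\<lambda>N. F (N(k := Suc (N k))))) / real CARD('d)"

lemma step_count_mean_mono:
  "(\<And>N. F N \<le> G N) \<Longrightarrow> step_count_mean t F \<le> step_count_mean t G"
  by (induction t arbitrary: F G) (auto intro!: divide_right_mono sum_mono)

lemma step_count_mean_nonneg:
  "(\<And>N. 0 \<le> F N) \<Longrightarrow> 0 \<le> step_count_mean t F"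
  by (induction t arbitrary: F) (auto intro!: divide_nonneg_nonneg sum_nonneg)

lemma step_count_mean_add:
  "step_count_mean t (\<lambda>N. F N + G N) = step_count_mean t F + step_count_mean t G"
  by (induction t arbitrary: F G) (auto simp: sum.distrib add_divide_distrib)

lemma step_count_mean_cmult:
  "step_count_mean t (\<lambda>N. c * F N) = c * step_count_mean t F"
  by (induction t arbitrary: F) (auto simp: sum_distrib_left[symmetric])

lemma step_count_mean_square_le:
  "(step_count_mean t F)\<^sup>2 \<le> step_count_mean t (\<lambda>N. (F N)\<^sup>2)"
proof (induction t arbitrary: F)
  case (Suc t)
  let ?x = "\<lambda>k. step_count_mean t (\<lambda>N. F (N(k := Suc (N k))))"
  have "(\<Sum>k\<in>UNIV. ?x k)\<^sup>2 \<le> real CARD('a) * (\<Sum>k\<in>UNIV. (?x k)\<^sup>2)"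
    using sum_squared_le_sum_of_squares[of ?x UNIV] by (simp add: mult.commute)
  also have "\<dots> \<le> real CARD('a) * (\<Sum>k\<in>UNIV. step_count_mean t (\<lambda>N. (F (N(k := Suc (N k))))\<^sup>2))"
    by (intro mult_left_mono sum_mono Suc) auto
  finally show ?case by (simp add: power_divide power2_eq_square field_simps)
qed simp

text \<open>Each of the \<open>t + 1\<close> steps has direction \<open>k\<close> with probability
  1/d, and deleting it leaves a walk of \<open>t\<close> steps. The truncated \<open>N k - 1\<close>
  is harmless, as its factor vanishes for \<open>N k = 0\<close>.\<close>

lemma step_count_mean_size_bias:
  fixes F :: "('d::finite \<Rightarrow> nat) \<Rightarrow> real"
  shows "step_count_mean (Suc t) (\<lambda>N. real (N k) * F (N(k := N k - 1)))
       = real (Suc t) / real CARD('d) * step_count_mean t F"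
proof (induction t arbitrary: F)
  case 0
  have "(\<lambda>_. 0)(k := Suc 0, k := 0) = (\<lambda>_. 0 :: nat)" by auto
  hence "real (((\<lambda>_. 0)(j := Suc 0)) k) * F ((\<lambda>_. 0)(j := Suc 0, k := ((\<lambda>_. 0)(j := Suc 0)) k - 1))
      = (if j = k then F (\<lambda>_. 0) else 0)" for j
    by (cases "j = k") auto
  thus ?case by (simp only: step_count_mean.simps) simp
next
  case (Suc t)
  let ?G = "\<lambda>N. real (N k) * F (N(k := N k - 1))"
  have *: "step_count_mean (Suc t) (\<lambda>N. ?G (N(j := Suc (N j)))) =
        real (Suc t) / real CARD('d) * step_count_mean t (\<lambda>N. F (N(j := Suc (N j))))
        + (if j = k then step_count_mean (Suc t) F else 0)" for j
  proof -
    \<comment> \<open>For \<open>j = k\<close> the factor becomes \<open>N k + 1\<close>, whose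
      extra 1 multiplies \<open>F N\<close>; for other \<open>j\<close> the two updates
      commute.\<close>
    have "?G (N(j := Suc (N j))) =
        real (N k) * (\<lambda>N. F (N(j := Suc (N j)))) (N(k := N k - 1)) + (if j = k then F N else 0)" for N
      by (cases "j = k"; cases "N k") (auto simp: fun_upd_twist algebra_simps fun_upd_idem)
    hence "(\<lambda>N. ?G (N(j := Suc (N j)))) = (\<lambda>N.
        real (N k) * (\<lambda>N. F (N(j := Suc (N j)))) (N(k := N k - 1)) + (if j = k then F N else 0))" by (rule ext)
    hence "step_count_mean (Suc t) (\<lambda>N. ?G (N(j := Suc (N j)))) = step_count_mean (Suc t) (\<lambda>N.
        real (N k) * (\<lambda>N. F (N(j := Suc (N j)))) (N(k := N k - 1)) + (if j = k then F N else 0))" by simp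
    also have "\<dots> = real (Suc t) / real CARD('d) * step_count_mean t (\<lambda>N. F (N(j := Suc (N j))))
        + step_count_mean (Suc t) (\<lambda>N. if j = k then F N else 0)"
      by (simp only: step_count_mean_add Suc[of "\<lambda>N. F (N(j := Suc (N j)))"])
    also have "step_count_mean (Suc t) (\<lambda>N. if j = k then F N else 0) = (if j = k then step_count_mean (Suc t) F else 0)"
      using step_count_mean_cmult[of "Suc t" 0 F] by auto
    finally show ?thesis .
  qed
  have "step_count_mean (Suc (Suc t)) ?G
      = (\<Sum>j\<in>UNIV. step_count_mean (Suc t) (\<lambda>N. ?G (N(j := Suc (N j))))) / real CARD('d)"
    by (rule step_count_mean.simps)
  also have "\<dots> = (real (Suc t) / real CARD('d) * (\<Sum>j\<in>UNIV. step_count_mean t (\<lambda>N. F (N(j := Suc (N j)))))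
        + step_count_mean (Suc t) F) / real CARD('d)"
    by (simp only: *) (simp add: sum.distrib sum_distrib_left)
  also have "(\<Sum>j\<in>UNIV. step_count_mean t (\<lambda>N. F (N(j := Suc (N j))))) = real CARD('d) * step_count_mean (Suc t) F"
    by simp
  finally show ?case by (simp only: ) (simp add: field_simps del: step_count_mean.simps)
qed

text \<open>Size biasing of \<open>G N / (N k + 1)\<close>: the factor \<open>N k\<close> cancels
  the denominator, and \<open>G\<close> does not see the change of \<open>N k\<close>.\<close>

lemma step_count_mean_divide_le:
  fixes G :: "('d::finite \<Rightarrow> nat) \<Rightarrow> real"
  assumes "\<And>N. 0 \<le> G N" "\<And>N m. G (N(k := m)) = G N"
  shows "step_count_mean t (\<lambda>N. G N / real (N k + 1)) \<le> real CARD('d) / real (t + 1) * step_count_mean (t + 1) G"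
proof -
  let ?F = "\<lambda>N. G N / real (N k + 1)"
  have "real (Suc t) / real CARD('d) * step_count_mean t ?F
      = step_count_mean (Suc t) (\<lambda>N. real (N k) * ?F (N(k := N k - 1)))"
    by (rule step_count_mean_size_bias[symmetric])
  also have "\<dots> \<le> step_count_mean (Suc t) G"
  proof (rule step_count_mean_mono)
    show "real (N k) * ?F (N(k := N k - 1)) \<le> G N" for N
      using assms(1)[of N] by (cases "N k") (auto simp: assms(2))
  qed
  finally show ?thesis by (simp add: field_simps del: step_count_mean.simps)
qed

lemma step_count_mean_1: "step_count_mean t (\<lambda>_. 1) = 1"
  by (induction t) auto

text \<open>Directions are removed one at a time. Each removal gains a factor d/(t + 1) but advances
  the time by 1, so the induction runs over all \<open>t\<close>.\<close>

lemma step_count_mean_prod_le: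
  fixes S :: "'d::finite set"
  assumes "t \<ge> 1"
  shows "step_count_mean t (\<lambda>N. \<Prod>k\<in>S. 1 / real (N k + 1)) \<le> (real CARD('d) / real t) ^ card S"
proof -
  have "finite S" by simp
  thus ?thesis using assms
  proof (induction S arbitrary: t rule: finite_induct)
    case empty
    show ?case by (simp add: step_count_mean_1)
  next
    case (insert k S)
    let ?G = "\<lambda>N. \<Prod>k\<in>S. 1 / real (N k + 1)"
    have "(\<lambda>N. \<Prod>k\<in>insert k S. 1 / real (N k + 1)) = (\<lambda>N. ?G N / real (N k + 1))"
      using insert by (simp add: mult.commute)
    moreover have "step_count_mean t (\<lambda>N. ?G N / real (N k + 1)) \<le> real CARD('d) / real (t + 1) * step_count_mean (t + 1) ?G"
      using insert.hyps by (intro step_count_mean_divide_le prod_nonneg prod.cong) auto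
    moreover have "\<dots> \<le> real CARD('d) / real t * (real CARD('d) / real t) ^ card S"
    proof (rule mult_mono)
      have "step_count_mean (t + 1) ?G \<le> (real CARD('d) / real (t + 1)) ^ card S" by (rule insert.IH) simp
      also have "\<dots> \<le> (real CARD('d) / real t) ^ card S"
        using insert.prems by (intro power_mono divide_left_mono) auto
      finally show "step_count_mean (t + 1) ?G \<le> (real CARD('d) / real t) ^ card S" .
      show "0 \<le> step_count_mean (t + 1) ?G" by (intro step_count_mean_nonneg prod_nonneg) auto
    qed (use insert.prems in \<open>auto intro: divide_left_mono\<close>)
    ultimately show ?case using insert.hyps by simp
  qed
qed

text \<open>Given the step counts, the coordinates are independent one-dimensional walks.\<close>

lemma kernel_step_count_mean:
  fixes n :: "int ^ 'd"
  shows "kernel t n = step_count_mean t (\<lambda>N. \<Prod>k\<in>UNIV. walk1 (N k) (n $ k))"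
proof (induction t arbitrary: n)
  case 0
  have "(\<Prod>k\<in>UNIV. walk1 0 (n $ k)) = (if n = 0 then 1 else 0)"
    by (auto simp: vec_eq_iff)
  thus ?case by (simp add: kernel_0)
next
  case (Suc t)
  let ?F = "\<lambda>n N. \<Prod>k\<in>UNIV. walk1 (N k) (n $ k)"
  have *: "?F n (N(k := Suc (N k))) = 1 / 2 * (?F (n + axis k 1) N + ?F (n - axis k 1) N)" for k N
  proof -
    define R where "R = (\<Prod>j\<in>UNIV - {k}. walk1 (N j) (n $ j))"
    have split: "?F m M = walk1 (M k) (m $ k) * R"
      if "\<And>j. j \<noteq> k \<Longrightarrow> M j = N j \<and> m $ j = n $ j" for m M
      unfolding R_def by (subst prod.remove[of _ k]) (auto intro!: prod.cong simp: that)
    have "?F n (N(k := Suc (N k))) = walk1 (Suc (N k)) (n $ k) * R" by (subst split) auto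
    moreover have "?F (n + axis k 1) N = walk1 (N k) (n $ k + 1) * R" by (subst split) (auto simp: axis_def)
    moreover have "?F (n - axis k 1) N = walk1 (N k) (n $ k - 1) * R" by (subst split) (auto simp: axis_def)
    ultimately show ?thesis by (simp add: algebra_simps)
  qed
  show ?case
    unfolding kernel_Suc neighbour_mean_def step_count_mean.simps * step_count_mean_cmult step_count_mean_add Suc
    by (simp add: sum_divide_distrib[symmetric] sum_distrib_left[symmetric])
qed

text \<open>Cauchy-Schwarz passes to squares, which \<open>walk1_sq_le\<close> bounds by reciprocals
  of step counts; taking the root at the end gives the exponent d/2.\<close>

lemma kernel_le:
  fixes n :: "int ^ 'd"
  assumes "t \<ge> 1"
  shows "kernel t n \<le> (real CARD('d) / real t) powr (real CARD('d) / 2)"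
proof -
  have "(kernel t n)\<^sup>2 \<le> step_count_mean t (\<lambda>N. (\<Prod>k\<in>UNIV. walk1 (N k) (n $ k))\<^sup>2)"
    unfolding kernel_step_count_mean by (rule step_count_mean_square_le)
  also have "\<dots> \<le> step_count_mean t (\<lambda>N. \<Prod>k::'d\<in>UNIV. 1 / real (N k + 1))"
    unfolding prod_power_distrib by (intro step_count_mean_mono prod_mono) (use walk1_sq_le in auto)
  also have "\<dots> \<le> (real CARD('d) / real t) ^ CARD('d)"
    by (rule step_count_mean_prod_le[OF assms])
  finally have "kernel t n \<le> sqrt ((real CARD('d) / real t) ^ CARD('d))"
    by (rule real_le_rsqrt)
  also have "\<dots> = (real CARD('d) / real t) powr (real CARD('d) / 2)"
    using assms by (simp add: powr_half_sqrt[symmetric] powr_powr powr_realpow[symmetric])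
  finally show ?thesis .
qed

subsection \<open>Global existence for small data\<close>

lemma neighbour_mean_funpow_le_norm1:
  fixes a :: "int ^ 'd \<Rightarrow> real"
  assumes "\<And>n. 0 \<le> a n" "(a has_sum A) UNIV" "t \<ge> 1"
  shows "(neighbour_mean ^^ t) a n \<le> (real CARD('d) / real t) powr (real CARD('d) / 2) * A"
  using assms
  by (intro has_sum_mono[OF kernel_convolution has_sum_cmult_right[OF assms(2)]])
     (auto intro!: mult_right_mono kernel_le)

lemma global_solution_unique:
  assumes "global_solution \<alpha> a f" "global_solution \<alpha> a f'"
  shows "f = f'"
proof -
  have "f t n = f' t n" for t n
  proof (induction t arbitrary: n)
    case 0
    show ?case using assms by (simp add: global_solutionD(1))
  next
    case (Suc t)
    hence "f t = f' t" by (rule ext)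
    thus ?case by (simp only: global_solutionD(5)[OF assms(1)] global_solutionD(5)[OF assms(2)])
  qed
  thus ?thesis by (intro ext)
qed

text \<open>The bound \<open>M\<^sup>t a / (e t)\<^bsup>1/\<alpha>\<^esup>\<close> is a supersolution: on it the recursion
  \<open>x\<^bsup>-\<alpha>\<^esup> \<mapsto> x\<^bsup>-\<alpha>\<^esup> - 1\<close> costs at most \<open>(B (t + 1))\<^bsup>\<alpha>\<^esup>\<close> in \<open>e\<close>.\<close>

lemma global_solution_exists:
  fixes a :: "int ^ 'd \<Rightarrow> real" and B :: "nat \<Rightarrow> real"
  assumes \<alpha>: "\<alpha> > 0" and a: "\<And>n. 0 \<le> a n"
    and B: "\<And>t n. (neighbour_mean ^^ Suc t) a n \<le> B t"
    and sum_B: "\<And>t. (\<Sum>j<t. B j powr \<alpha>) < 1"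
  shows "\<exists>f. global_solution \<alpha> a f"
proof -
  define f where "f = rec_nat a (\<lambda>_ u n. neighbour_mean u n / (1 - neighbour_mean u n powr \<alpha>) powr (1 / \<alpha>))"
  have f0: "f 0 = a" by (simp add: f_def)
  have fS: "f (Suc t) n = neighbour_mean (f t) n / (1 - neighbour_mean (f t) n powr \<alpha>) powr (1 / \<alpha>)" for t n
    by (simp add: f_def)
  \<comment> \<open>The budget left at time \<open>t\<close>: it starts at 1, and
    \<open>sum_B\<close> keeps it positive.\<close>
  define e where "e t = 1 - (\<Sum>j<t. B j powr \<alpha>)" for t
  have e: "e t > 0" for t using sum_B[of t] by (simp add: e_def)
  have f_nonneg: "0 \<le> f t n" for t n
    by (induction t arbitrary: n) (auto simp: f0 fS a intro!: divide_nonneg_nonneg neighbour_mean_nonneg)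
  hence g_nonneg: "0 \<le> neighbour_mean (f t) n" for t n by (rule neighbour_mean_nonneg)
  have step: "neighbour_mean (f t) n < 1 \<and> f (Suc t) n \<le> e (Suc t) powr (- (1 / \<alpha>)) * (neighbour_mean ^^ Suc t) a n"
    if IH: "\<And>n. f t n \<le> e t powr (- (1 / \<alpha>)) * (neighbour_mean ^^ t) a n" for t n
  proof -
    let ?g = "neighbour_mean (f t) n" and ?u = "(neighbour_mean ^^ Suc t) a n"
    have u: "0 \<le> ?u" by (intro neighbour_mean_funpow_nonneg a)
    have "?g \<le> neighbour_mean (\<lambda>n. e t powr (- (1 / \<alpha>)) * (neighbour_mean ^^ t) a n) n"
      by (intro neighbour_mean_mono IH)
    hence gu: "?g \<le> e t powr (- (1 / \<alpha>)) * ?u" by (simp add: neighbour_mean_cmult)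
    hence "?g powr \<alpha> \<le> (e t powr (- (1 / \<alpha>)) * ?u) powr \<alpha>"
      using g_nonneg \<alpha> by (intro powr_mono2) auto
    also have "\<dots> = (e t powr (- (1 / \<alpha>))) powr \<alpha> * ?u powr \<alpha>"
      by (rule powr_mult)
    also have "(e t powr (- (1 / \<alpha>))) powr \<alpha> = e t powr (- 1)" using \<alpha> by (simp add: powr_powr)
    also have "e t powr (- 1) * ?u powr \<alpha> = ?u powr \<alpha> / e t"
      using e[of t] by (simp add: powr_minus divide_inverse)
    also have "\<dots> \<le> B t powr \<alpha> / e t"
      using e[of t] u B \<alpha> by (intro divide_right_mono powr_mono2) (auto intro: less_imp_le)
    finally have "1 - ?g powr \<alpha> \<ge> (e t - B t powr \<alpha>) / e t" using e[of t] by (simp add: diff_divide_distrib)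
    \<comment> \<open>This inequality yields both \<open>?g < 1\<close> and, raised to the power
      \<open>1 / \<alpha>\<close>, the replacement of \<open>e t\<close> by \<open>e (Suc t)\<close>
      in the prefactor.\<close>
    hence low: "1 - ?g powr \<alpha> \<ge> e (Suc t) / e t" by (simp add: e_def diff_diff_eq)
    moreover have ee: "e (Suc t) / e t > 0" using e by simp
    ultimately have "?g powr \<alpha> < 1" by linarith
    hence g1: "?g < 1" using powr_mono2[of \<alpha> 1 ?g] \<alpha> by force
    have "0 < (e (Suc t) / e t) powr (1 / \<alpha>)" using ee by (metis less_irrefl powr_gt_zero)
    moreover have "(e (Suc t) / e t) powr (1 / \<alpha>) \<le> (1 - ?g powr \<alpha>) powr (1 / \<alpha>)"
      using \<alpha> by (intro powr_mono2 low less_imp_le[OF ee]) auto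
    ultimately have "f (Suc t) n \<le> ?g / (e (Suc t) / e t) powr (1 / \<alpha>)"
      unfolding fS by (intro divide_left_mono g_nonneg mult_pos_pos) auto
    also have "\<dots> \<le> (e t powr (- (1 / \<alpha>)) * ?u) / (e (Suc t) / e t) powr (1 / \<alpha>)"
      by (intro divide_right_mono gu) auto
    also have "\<dots> = e (Suc t) powr (- (1 / \<alpha>)) * ?u"
      using e[of t] e[of "Suc t"] by (simp add: powr_divide powr_minus divide_simps)
    finally show ?thesis using g1 by simp
  qed
  have super: "f t n \<le> e t powr (- (1 / \<alpha>)) * (neighbour_mean ^^ t) a n" for t n
    by (induction t arbitrary: n) (use step in \<open>auto simp: f0 e_def\<close>)
  have "global_solution \<alpha> a f"
    using step[OF super] f_nonneg f0 fS by (simp add: global_solution_def solves_ivp_def Let_def)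
  thus ?thesis by (rule exI[of _ f])
qed

text \<open>Summability is demanded explicitly because the infinite sum of a non-summable family is
  0 by convention.\<close>

lemma global_solution_supercritical:
  fixes \<alpha> :: real
  assumes "\<alpha> > 2 / real CARD('d::finite)"
  shows "\<exists>\<epsilon>>0. \<forall>a :: int ^ 'd \<Rightarrow> real. (\<forall>n. 0 \<le> a n) \<and> (\<exists>n. a n \<noteq> 0) \<and>
              (\<lambda>n. \<bar>a n\<bar>) summable_on UNIV \<and> (\<Sum>\<^sub>\<infinity>n. \<bar>a n\<bar>) < \<epsilon> \<longrightarrow>
              (\<exists>!f. global_solution \<alpha> a f)"
proof -
  let ?d = "real CARD('d)"
  have d: "?d > 0" by simp
  have \<alpha>: "\<alpha> > 0" using assms d by (meson divide_pos_pos less_trans zero_less_numeral)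
  \<comment> \<open>The heat kernel bound at time \<open>t + 1\<close>, matching the index shift of
    \<open>B\<close> in \<open>global_solution_exists\<close>.\<close>
  define b where "b t = (?d / real (Suc t)) powr (?d / 2)" for t
  define Z where "Z = (\<Sum>t. b t powr \<alpha>)"
  have b_pos: "b t > 0" for t by (simp add: b_def)
  \<comment> \<open>Supercriticality is exactly the convergence of this power series of
    times.\<close>
  have "- (?d / 2 * \<alpha>) < -1" using assms d by (simp add: field_simps)
  hence "summable (\<lambda>t. real t powr (- (?d / 2 * \<alpha>)))" by (simp add: summable_real_powr_iff)
  hence "summable (\<lambda>t. real (Suc t) powr (- (?d / 2 * \<alpha>)))"
    by (subst summable_Suc_iff)
  hence "summable (\<lambda>t. ?d powr (?d / 2 * \<alpha>) * real (Suc t) powr (- (?d / 2 * \<alpha>)))" by (rule summable_mult)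
  also have "(\<lambda>t. ?d powr (?d / 2 * \<alpha>) * real (Suc t) powr (- (?d / 2 * \<alpha>))) = (\<lambda>t. b t powr \<alpha>)"
    by (simp only: b_def powr_powr powr_divide powr_minus_divide times_divide_eq_right mult_1_right)
  finally have summ: "summable (\<lambda>t. b t powr \<alpha>)" .
  have Z: "Z > 0" unfolding Z_def by (intro suminf_pos summ) (use b_pos in \<open>auto simp: order_less_le\<close>)
  \<comment> \<open>Chosen so that the total cost is at most
    \<open>Z * \<epsilon> powr \<alpha> = 1 / 2\<close>, below the budget 1.\<close>
  define \<epsilon> where "\<epsilon> = (1 / (2 * Z)) powr (1 / \<alpha>)"
  have \<epsilon>: "\<epsilon> > 0" "\<epsilon> powr \<alpha> = 1 / (2 * Z)" using Z \<alpha> by (auto simp: \<epsilon>_def powr_powr)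
  have small_data: "\<exists>!f. global_solution \<alpha> a f"
    if a: "\<And>n. 0 \<le> a n" and summ_a: "a summable_on UNIV" and small: "(\<Sum>\<^sub>\<infinity>n. a n) < \<epsilon>" for a :: "int ^ 'd \<Rightarrow> real"
  proof -
    have "\<exists>f. global_solution \<alpha> a f"
    proof (rule global_solution_exists[OF \<alpha> a, where B = "\<lambda>t. b t * \<epsilon>"])
      fix t n
      have "(neighbour_mean ^^ Suc t) a n \<le> b t * (\<Sum>\<^sub>\<infinity>n. a n)"
        unfolding b_def by (intro neighbour_mean_funpow_le_norm1 a has_sum_infsum summ_a) simp
      also have "\<dots> \<le> b t * \<epsilon>" using small b_pos[of t] by (intro mult_left_mono) auto
      finally show "(neighbour_mean ^^ Suc t) a n \<le> b t * \<epsilon>" .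
    next
      fix t
      have "(\<Sum>j<t. (b j * \<epsilon>) powr \<alpha>) = (\<Sum>j<t. b j powr \<alpha>) * (1 / (2 * Z))"
        using b_pos \<epsilon> by (simp add: powr_mult sum_divide_distrib)
      also have "\<dots> \<le> Z * (1 / (2 * Z))"
        using Z by (intro mult_right_mono) (auto simp: Z_def intro: sum_le_suminf summ)
      also have "\<dots> < 1" using Z by simp
      finally show "(\<Sum>j<t. (b j * \<epsilon>) powr \<alpha>) < 1" .
    qed
    thus ?thesis using global_solution_unique by blast
  qed
  show ?thesis
  proof (intro exI[of _ \<epsilon>] conjI allI impI \<epsilon>(1))
    fix a :: "int ^ 'd \<Rightarrow> real"
    assume *: "(\<forall>n. 0 \<le> a n) \<and> (\<exists>n. a n \<noteq> 0) \<and>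
      (\<lambda>n. \<bar>a n\<bar>) summable_on UNIV \<and> (\<Sum>\<^sub>\<infinity>n. \<bar>a n\<bar>) < \<epsilon>"
    hence "(\<lambda>n. \<bar>a n\<bar>) = a" by (simp add: fun_eq_iff)
    with * show "\<exists>!f. global_solution \<alpha> a f" by (intro small_data) simp_all
  qed
qed

theorem theorem2p3:
  fixes \<alpha> :: real
  assumes "\<alpha> > 0"
  shows "(\<alpha> < 2 / real CARD('d::finite) \<longrightarrow>
           (\<forall>a :: int ^ 'd \<Rightarrow> real. (\<forall>n. 0 \<le> a n) \<and> (\<exists>n. a n \<noteq> 0) \<longrightarrow>
              \<not> (\<exists>f. global_solution \<alpha> a f)))
       \<and> (\<alpha> = 2 / real CARD('d) \<longrightarrow>
           (\<forall>a :: int ^ 'd \<Rightarrow> real. (\<forall>n. 0 \<le> a n) \<and> (\<exists>n. a n \<noteq> 0) \<longrightarrow>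
              \<not> (\<exists>f. global_solution \<alpha> a f)))
       \<and> (\<alpha> > 2 / real CARD('d) \<longrightarrow>
           (\<exists>\<epsilon>>0. \<forall>a :: int ^ 'd \<Rightarrow> real. (\<forall>n. 0 \<le> a n) \<and> (\<exists>n. a n \<noteq> 0) \<and>
              (\<lambda>n. \<bar>a n\<bar>) summable_on UNIV \<and> (\<Sum>\<^sub>\<infinity>n. \<bar>a n\<bar>) < \<epsilon> \<longrightarrow>
              (\<exists>!f. global_solution \<alpha> a f)))"
proof (intro conjI impI)
  assume "\<alpha> < 2 / real CARD('d)"
  thus "\<forall>a :: int ^ 'd \<Rightarrow> real. (\<forall>n. 0 \<le> a n) \<and> (\<exists>n. a n \<noteq> 0) \<longrightarrow> \<not> (\<exists>f. global_solution \<alpha> a f)"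
    using no_global_solution_subcritical[OF assms] by blast
next
  assume "\<alpha> = 2 / real CARD('d)"
  thus "\<forall>a :: int ^ 'd \<Rightarrow> real. (\<forall>n. 0 \<le> a n) \<and> (\<exists>n. a n \<noteq> 0) \<longrightarrow> \<not> (\<exists>f. global_solution \<alpha> a f)"
    using no_global_solution_critical by blast
qed (rule global_solution_supercritical)

end
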